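(* For every integer $k\ge 1$, the following six identities hold: \begin{align*} \frac{1}{2}(F_{6k-1}-1)F_{6k} + \frac{1}{2}(F_{6k-1}-1)F_{6k+1} &= \frac{(F_{6k}-1)(F_{6k+1}-1)}{2},\\ \frac{1}{2}(F_{6k+1}-1)F_{6k+1} + \frac{1}{2}(F_{6k-1}-1)F_{6k+2} &= \frac{(F_{6k+1}-1)(F_{6k+2}-1)}{2},\\ \frac{1}{2}(F_{6k+1}-1)F_{6k+2} + \frac{1}{2}(F_{6k+1}-1)F_{6k+3} &= \frac{(F_{6k+2}-1)(F_{6k+3}-1)}{2},\\ 1+\frac{1}{2}(F_{6k+2}-1)F_{6k+3} + \frac{1}{2}(F_{6k+2}-1)F_{6k+4} &= \frac{(F_{6k+3}-1)(F_{6k+4}-1)}{2},\\ 1+\frac{1}{2}(F_{6k+4}-1)F_{6k+4} + \frac{1}{2}(F_{6k+2}-1)F_{6k+5} &= \frac{(F_{6k+4}-1)(F_{6k+5}-1)}{2},\\ 1+\frac{1}{2}(F_{6k+4}-1)F_{6k+5} + \frac{1}{2}(F_{6k+4}-1)F_{6k+6} &= \frac{(F_{6k+5}-1)(F_{6k+6}-1)}{2}. \end{align*}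
   Context: $F_n$ denotes the $n$-th Fibonacci number, indexed by $F_1=1$, $F_2=1$, $F_{n+2}=F_{n+1}+F_n$ (so $F_3=2$, $F_4=3$, $F_5=5$, ...). The divisions by $2$ are ordinary divisions of rational numbers. *)

theory Defs
  imports Complex_Main "HOL-Number_Theory.Fib"
begin

abbreviation F :: "nat \<Rightarrow> rat" where
  "F n \<equiv> of_nat (fib n)"

end

theory Submission
  imports Defs
begin

text \<open>With \<open>a\<close> = F(6k-1) and \<open>b\<close> = F(6k), every Fibonacci number
  involved is a linear form in \<open>a\<close> and \<open>b\<close>. After doubling, the linear
  terms of each identity cancel and left minus right is q = a^2 + ab - b^2 - 1 in the first three
  identities and -q in the last three. Cassini's identity at the odd index 6k-1 says exactly q =
  0.\<close>

theorem theorem1p4: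
  fixes k :: nat
  assumes "k \<ge> 1"
  shows "(1/2 * (F (6*k-1) - 1) * F (6*k) + 1/2 * (F (6*k-1) - 1) * F (6*k+1) = (F (6*k) - 1) * (F (6*k+1) - 1) / 2) \<and>
         (1/2 * (F (6*k+1) - 1) * F (6*k+1) + 1/2 * (F (6*k-1) - 1) * F (6*k+2) = (F (6*k+1) - 1) * (F (6*k+2) - 1) / 2) \<and>
         (1/2 * (F (6*k+1) - 1) * F (6*k+2) + 1/2 * (F (6*k+1) - 1) * F (6*k+3) = (F (6*k+2) - 1) * (F (6*k+3) - 1) / 2) \<and>
         (1 + 1/2 * (F (6*k+2) - 1) * F (6*k+3) + 1/2 * (F (6*k+2) - 1) * F (6*k+4) = (F (6*k+3) - 1) * (F (6*k+4) - 1) / 2) \<and>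
         (1 + 1/2 * (F (6*k+4) - 1) * F (6*k+4) + 1/2 * (F (6*k+2) - 1) * F (6*k+5) = (F (6*k+4) - 1) * (F (6*k+5) - 1) / 2) \<and>
         (1 + 1/2 * (F (6*k+4) - 1) * F (6*k+5) + 1/2 * (F (6*k+4) - 1) * F (6*k+6) = (F (6*k+5) - 1) * (F (6*k+6) - 1) / 2)"
proof -
  define a b where "a = F (6*k-1)" and "b = F (6*k)"
  \<comment> \<open>As k is positive, 6k-1 is a true predecessor, not a truncated difference;
    \<open>m\<close> names it so that the Fibonacci recursion applies.\<close>
  obtain m where m: "6 * k = Suc m"
    using assms by (cases "6 * k") auto
  have F1: "F (6*k+1) = a + b"
    by (simp add: a_def b_def m)
  have F2: "F (6*k+2) = a + 2 * b" and F3: "F (6*k+3) = 2 * a + 3 * b"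
    and F4: "F (6*k+4) = 3 * a + 5 * b" and F5: "F (6*k+5) = 5 * a + 8 * b"
    and F6: "F (6*k+6) = 8 * a + 13 * b"
    using F1 by (simp_all add: numeral_eq_Suc b_def)
  \<comment> \<open>The parity of the index fixes the sign in Cassini's identity: +1 here.\<close>
  have "odd m"
    by (metis m even_Suc even_mult_iff even_numeral)
  then have "fib (6*k+1) * fib (6*k-1) = (fib (6*k))\<^sup>2 + 1"
    using fib_Cassini_nat[of m] by (simp add: m)
  then have "F (6*k+1) * F (6*k-1) = (F (6*k))\<^sup>2 + 1"
    by (metis of_nat_1 of_nat_add of_nat_mult of_nat_power)
  then have "(a + b) * a = b\<^sup>2 + 1"
    unfolding F1 by (simp add: a_def b_def)
  \<comment> \<open>Cassini oriented as a rewrite rule that eliminates the square of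
    \<open>a\<close>; once products are expanded, both sides of each identity become the same
    polynomial.\<close>
  then have "a * a = b * b + 1 - a * b"
    by (simp add: algebra_simps power2_eq_square)
  then show ?thesis
    unfolding F1 F2 F3 F4 F5 F6 a_def[symmetric] b_def[symmetric]
    by (simp add: field_simps)
qed

end
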